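(* Let $k\ge 1$ and consider the fully discrete $\mathbb{Q}^k$ scheme (Steps 1–5 described in the context) with periodic boundary conditions. Assume the quadrature rules used in the hyperbolic subproblem and in the parabolic subproblem are both exact for integrating polynomials of degree $k$ (i.e. for functions in $\mathbb{Q}^k(K)$ on each cell $K$). Then the scheme conserves density, momentum, and total energy: if $\mathbf{U}_h^{n+1}=[\rho_h^{n+1},\mathbf{m}_h^{n+1},E_h^{n+1}]^{\mathrm T}$ is produced from $\mathbf{U}_h^{n}=[\rho_h^{n},\mathbf{m}_h^{n},E_h^{n}]^{\mathrm T}$ by one time step of the scheme, then $$(\rho_h^{n},1)=(\rho_h^{n+1},1),\qquad (\mathbf{m}_h^{n},\mathbf{1})=(\mathbf{m}_h^{n+1},\mathbf{1}),\qquad (E_h^{n},1)=(E_h^{n+1},1).$$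
   Context: **Mesh and spaces.** $d\in\{1,2\}$; $\Omega\subset\mathbb{R}^d$ is partitioned into a mesh $\mathcal{T}_h$ of equal intervals ($d=1$) or equal squares ($d=2$), with periodic boundary conditions, so that every face is an interior face; $h$ is the cell diameter. $\mathbb{Q}^k(K)$ is the space of tensor-product polynomials of degree $k$ on $K$. $M_h^k=\{\chi\in L^2(\Omega):\chi|_K\in\mathbb{Q}^k(K)\ \forall K\}$ and $\mathbf{X}_h^k=\{\boldsymbol\theta\in L^2(\Omega)^d:\boldsymbol\theta|_K\in\mathbb{Q}^k(K)^d\ \forall K\}$. $\Gamma_h$ is the set of interior faces; each $e\in\Gamma_h$ shared by cells $K_{i^-},K_{i^+}$ has unit normal $\mathbf{n}_e$ pointing from $K_{i^-}$ to $K_{i^+}$; $\{\omega\}=\frac12(\omega|_{K_{i^-}}+\omega|_{K_{i^+}})$ and $[\omega]=\omega|_{K_{i^-}}-\omega|_{K_{i^+}}$ on $e$. **Quadratures.** $(\cdot,\cdot)$ and $\langle\cdot,\cdot\rangle$ are the $L^2$ inner products on $\Omega$ evaluated (cell by cell) with the quadrature rules used in the hyperbolic and the parabolic subproblems, respectively. All integrals in the hyperbolic (resp. parabolic) forms are evaluated with the quadrature rules on cells and faces of that subproblem (one fixed rule per face, and the same rule for all parabolic forms). $(\mathbf{m}_h,\mathbf{1})$ is understood componentwise, i.e. as the vector of the numbers $(m_{h,\ell},1)$, $\ell=1,\dots,d$. **Physical parameters.** $\gamma>1$; $\mathrm{Re}>0$; $\lambda>0$; time step $\Delta t>0$; penalties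 $\sigma,\tilde\sigma\ge 0$. For $\mathbf{U}=[\rho,\mathbf{m},E]^{\mathrm T}$: $\mathbf{u}=\mathbf{m}/\rho$, $\rho e(\mathbf{U})=E-\frac{\|\mathbf{m}\|^2}{2\rho}$, $p=(\gamma-1)\rho e$, and $\mathbf{F}^{\mathrm a}(\mathbf{U})=[\rho\mathbf{u},\rho\mathbf{u}\otimes\mathbf{u}+p\mathbf{I},(E+p)\mathbf{u}]^{\mathrm T}$. $\boldsymbol\varepsilon(\mathbf{u})=\frac12(\nabla\mathbf{u}+(\nabla\mathbf{u})^{\mathrm T})$. **Hyperbolic DG operator.** The semi-discrete scheme on cell $K$ is: for all $\Psi\in\mathbb{Q}^k(K)$, $$\frac{\mathrm d}{\mathrm dt}\int_K\mathbf{U}_h\Psi=\int_K\mathbf{F}^{\mathrm a}(\mathbf{U}_h)\cdot\nabla\Psi-\int_{\partial K}\widehat{\mathbf{F}^{\mathrm a}\cdot\mathbf{n}_K}(\mathbf{U}_h^-,\mathbf{U}_h^+)\Psi,$$ with local Lax–Friedrichs flux $\widehat{\mathbf{F}^{\mathrm a}\cdot\mathbf{n}_K}=\frac12(\mathbf{F}^{\mathrm a}(\mathbf{U}_h^-)+\mathbf{F}^{\mathrm a}(\mathbf{U}_h^+))\cdot\mathbf{n}_K-\frac{\alpha_e}{2}(\mathbf{U}_h^+-\mathbf{U}_h^-)$ on each face $e\subset\partial K$, where $\mathbf{U}_h^-$ (resp. $\mathbf{U}_h^+$) is the trace from inside (resp. outside) $K$, $\mathbf{n}_K$ is the unit outward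 normal, and $\alpha_e$ is the maximum of $|\mathbf{u}\cdot\mathbf{n}_K|+\sqrt{\gamma p/\rho}$ over both traces along $e$ (one number per face). Writing this as $\frac{\mathrm d}{\mathrm dt}\mathbf{U}_h=L_h(\mathbf{U}_h)$, the SSP Runge–Kutta method with step $\tau$ is $\mathbf{U}^{(1)}=\mathbf{U}_h+\tau L_h(\mathbf{U}_h)$, $\mathbf{U}^{(2)}=\frac34\mathbf{U}_h+\frac14[\mathbf{U}^{(1)}+\tau L_h(\mathbf{U}^{(1)})]$, $\mathbf{U}^{(3)}=\frac13\mathbf{U}_h+\frac23[\mathbf{U}^{(2)}+\tau L_h(\mathbf{U}^{(2)})]$, where each stage is post-processed by the limiter below before being used further. **Positivity-preserving limiter.** For $\epsilon>0$ let $G^\epsilon=\{[\rho,\mathbf{m},E]^{\mathrm T}:\rho\ge\epsilon,\ E-\frac{\|\mathbf{m}\|^2}{2\rho}\ge\epsilon\}$. Let $S_K\subset K$ be a prescribed finite set of points and assume the cell average $\overline{\mathbf{U}}_K\in G^\epsilon$. The limiter replaces $\mathbf{U}_K=[\rho_K,\mathbf{m}_K,E_K]^{\mathrm T}$ by: (1) $\hat\rho_K=\theta_\rho(\rho_K-\overline\rho_K)+\overline\rho_K$ with $\theta_\rho=\min\{1,\frac{\overline\rho_K-\epsilon}{\overline\rho_K-\min_{S_K}\rho_K}\}$; (2) with $\widehat{\mathbf{U}}=[\hat\rho_K,\mathbf{m}_K,E_K]^{\mathrm T}$, $\widetilde{\mathbf{U}}_K=\theta_e(\widehat{\mathbf{U}}-\overline{\mathbf{U}}_K)+\overline{\mathbf{U}}_K$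 with $\theta_e=\min\{1,\frac{\overline{\rho e}_K-\epsilon}{\overline{\rho e}_K-\min_{S_K}\rho e(\widehat{\mathbf{U}})}\}$, $\overline{\rho e}_K=\rho e(\overline{\mathbf{U}}_K)$. (No limiting is done, i.e. $\theta_\rho=1$ or $\theta_e=1$, when the corresponding minimum over $S_K$ is already $\ge\epsilon$.) **Parabolic forms** (periodic case): $$a_{\varepsilon}(\mathbf{u},\boldsymbol\theta)=2\sum_K\int_K\boldsymbol\varepsilon(\mathbf{u}):\boldsymbol\varepsilon(\boldsymbol\theta)-2\sum_{e\in\Gamma_h}\int_e\{\boldsymbol\varepsilon(\mathbf{u})\mathbf{n}_e\}\cdot[\boldsymbol\theta]+2\sum_{e\in\Gamma_h}\int_e\{\boldsymbol\varepsilon(\boldsymbol\theta)\mathbf{n}_e\}\cdot[\mathbf{u}]+\frac{\sigma}{h}\sum_{e\in\Gamma_h}\int_e[\mathbf{u}]\cdot[\boldsymbol\theta],$$ $$a_\lambda(\mathbf{u},\boldsymbol\theta)=-\sum_K\int_K(\nabla\cdot\mathbf{u})(\nabla\cdot\boldsymbol\theta)+\sum_{e\in\Gamma_h}\int_e\{\nabla\cdot\mathbf{u}\}[\boldsymbol\theta\cdot\mathbf{n}_e]-\sum_{e\in\Gamma_h}\int_e\{\nabla\cdot\boldsymbol\theta\}[\mathbf{u}\cdot\mathbf{n}_e],$$ $$a_{\mathcal D}(e,\chi)=\sum_K\int_K\nabla e\cdot\nabla\chi-\sum_{e'\in\Gamma_h}\int_{e'}\{\nabla e\cdot\mathbf{n}_{e'}\}[\chi]+\frac{\tilde\sigma}{h}\sum_{e'\in\Gamma_h}\int_{e'}[e][\chi],$$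 $$b_\varepsilon(\mathbf{u},\chi)=2\sum_K\int_K\boldsymbol\varepsilon(\mathbf{u}):\boldsymbol\varepsilon(\mathbf{u})\chi+\frac{\sigma}{h}\sum_{e\in\Gamma_h}\int_e[\mathbf{u}]\cdot[\mathbf{u}]\{\chi\},\qquad b_\lambda(\mathbf{u},\chi)=-\sum_K\int_K(\nabla\cdot\mathbf{u})(\nabla\cdot\mathbf{u})\chi .$$ **One step of the scheme** $\mathbf{U}_h^n\mapsto\mathbf{U}_h^{n+1}$ (all in $M_h^k\times\mathbf{X}_h^k\times M_h^k$): - Step 1. $\mathbf{U}_h^{\mathrm H}=[\rho_h^{\mathrm H},\mathbf{m}_h^{\mathrm H},E_h^{\mathrm H}]^{\mathrm T}$ is obtained from $\mathbf{U}_h^n$ by the Runge–Kutta DG method with limiter, with step $\Delta t/2$. - Step 2. $(\mathbf{u}_h^{\mathrm H},e_h^{\mathrm H})\in\mathbf{X}_h^k\times M_h^k$ satisfies $\langle\mathbf{m}_h^{\mathrm H},\boldsymbol\theta_h\rangle=\langle\rho_h^{\mathrm H}\mathbf{u}_h^{\mathrm H},\boldsymbol\theta_h\rangle$ for all $\boldsymbol\theta_h\in\mathbf{X}_h^k$ and $\langle E_h^{\mathrm H},\chi_h\rangle=\langle\rho_h^{\mathrm H}e_h^{\mathrm H},\chi_h\rangle+\frac12\langle\rho_h^{\mathrm H}\mathbf{u}_h^{\mathrm H},\mathbf{u}_h^{\mathrm H}\chi_h\rangle$ for all $\chi_h\in M_h^k$. - Step 3. Set $\rho_h^{\mathrm P}=\rho_h^{\mathrm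 H}$. Find $\mathbf{u}_h^*\in\mathbf{X}_h^k$ with $\langle\rho_h^{\mathrm P}\mathbf{u}_h^*,\boldsymbol\theta_h\rangle+\frac{\Delta t}{2\mathrm{Re}}a_\varepsilon(\mathbf{u}_h^*,\boldsymbol\theta_h)+\frac{\Delta t}{3\mathrm{Re}}a_\lambda(\mathbf{u}_h^*,\boldsymbol\theta_h)=\langle\rho_h^{\mathrm H}\mathbf{u}_h^{\mathrm H},\boldsymbol\theta_h\rangle$ for all $\boldsymbol\theta_h\in\mathbf{X}_h^k$; set $\mathbf{u}_h^{\mathrm P}=2\mathbf{u}_h^*-\mathbf{u}_h^{\mathrm H}$. Then find $e_h^{\mathrm P}\in M_h^k$ with $\langle\rho_h^{\mathrm P}e_h^{\mathrm P},\chi_h\rangle+\frac{\Delta t\lambda}{\mathrm{Re}}a_{\mathcal D}(e_h^{\mathrm P},\chi_h)=\langle\rho_h^{\mathrm H}e_h^{\mathrm H},\chi_h\rangle+\frac{\Delta t}{\mathrm{Re}}b_\varepsilon(\mathbf{u}_h^*,\chi_h)+\frac{2\Delta t}{3\mathrm{Re}}b_\lambda(\mathbf{u}_h^*,\chi_h)$ for all $\chi_h\in M_h^k$. - Step 4. $(\mathbf{m}_h^{\mathrm P},E_h^{\mathrm P})$ satisfies $\langle\mathbf{m}_h^{\mathrm P},\boldsymbol\theta_h\rangle=\langle\rho_h^{\mathrm P}\mathbf{u}_h^{\mathrm P},\boldsymbol\theta_h\rangle$ for all $\boldsymbol\theta_h\in\mathbf{X}_h^k$ and $\langle E_h^{\mathrm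 P},\chi_h\rangle=\langle\rho_h^{\mathrm P}e_h^{\mathrm P},\chi_h\rangle+\frac12\langle\rho_h^{\mathrm P}\mathbf{u}_h^{\mathrm P},\mathbf{u}_h^{\mathrm P}\chi_h\rangle$ for all $\chi_h\in M_h^k$; then $\mathbf{U}_h^{\mathrm P}=[\rho_h^{\mathrm P},\mathbf{m}_h^{\mathrm P},E_h^{\mathrm P}]^{\mathrm T}$ is post-processed by the limiter. - Step 5. $\mathbf{U}_h^{n+1}$ is obtained from $\mathbf{U}_h^{\mathrm P}$ by the Runge–Kutta DG method with limiter, with step $\Delta t/2$. It is assumed that the steps are well defined (the intermediate solutions exist and the limiter is applied only where cell averages lie in $G^\epsilon$). *)

theory Defs
  imports "HOL-Analysis.Analysis"
begin

section \<open>Periodic mesh\<close>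

text \<open>
  The domain is the box with lower corner \<open>origin M\<close> that consists of \<open>ncells M i\<close> equal cubes of
  edge length \<open>side M\<close> in each coordinate direction \<open>i\<close>; cells are named by their multi-index.
  The pair \<open>(K, i)\<close> names the upper face of the cell \<open>K\<close> in direction \<open>i\<close>, which by periodicity is
  also the lower face of the cell \<open>next_cell M i K\<close>. Every face has exactly one such name.
  \<open>forward M e\<close> fixes the orientation of \<open>e\<close>: it holds if the normal of \<open>e\<close> points in the positive
  coordinate direction.
\<close>

type_synonym 'd cell = "'d \<Rightarrow> nat"
type_synonym 'd face = "'d cell \<times> 'd"

record ('d::finite) mesh =
  origin :: "real ^ 'd"
  side :: real
  ncells :: "'d \<Rightarrow> nat"
  forward :: "'d face \<Rightarrow> bool"

definition wf_mesh :: "'d::finite mesh \<Rightarrow> bool" where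
  "wf_mesh M \<longleftrightarrow> side M > 0 \<and> (\<forall>i. ncells M i \<ge> 1)"

definition cells :: "'d::finite mesh \<Rightarrow> 'd cell set" where
  "cells M = {K. \<forall>i. K i < ncells M i}"

definition corner :: "'d::finite mesh \<Rightarrow> 'd cell \<Rightarrow> real ^ 'd" where
  "corner M K = origin M + (\<chi> i. real (K i) * side M)"

definition cell :: "'d::finite mesh \<Rightarrow> 'd cell \<Rightarrow> (real ^ 'd) set" where
  "cell M K = cbox (corner M K) (corner M K + (\<chi> i. side M))"

definition mesh_size :: "'d::finite mesh \<Rightarrow> real" where
  "mesh_size M = diameter (cell M (\<lambda>_. 0))"

definition next_cell :: "'d::finite mesh \<Rightarrow> 'd \<Rightarrow> 'd cell \<Rightarrow> 'd cell" where
  "next_cell M i K = K(i := if Suc (K i) = ncells M i then 0 else Suc (K i))"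

definition prev_cell :: "'d::finite mesh \<Rightarrow> 'd \<Rightarrow> 'd cell \<Rightarrow> 'd cell" where
  "prev_cell M i K = K(i := if K i = 0 then ncells M i - 1 else K i - 1)"

definition faces :: "'d::finite mesh \<Rightarrow> 'd face set" where
  "faces M = cells M \<times> UNIV"

definition face_set :: "'d::finite mesh \<Rightarrow> 'd face \<Rightarrow> (real ^ 'd) set" where
  "face_set M e = {x \<in> cell M (fst e). x $ snd e = corner M (fst e) $ snd e + side M}"

text \<open>
  A point of the face \<open>(K, i)\<close>, given as a point of \<open>K\<close>, has the coordinates \<open>wrap M (K, i) x\<close> in the
  cell on the other side; the two differ by a period if the face lies on the boundary of the box.
\<close>

definition wrap :: "'d::finite mesh \<Rightarrow> 'd face \<Rightarrow> real ^ 'd \<Rightarrow> real ^ 'd" where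
  "wrap M e x =
     (if Suc (fst e (snd e)) = ncells M (snd e)
      then x - axis (snd e) (real (ncells M (snd e)) * side M) else x)"

section \<open>Discrete spaces\<close>

definition Qpoly :: "nat \<Rightarrow> (real ^ 'd::finite \<Rightarrow> real) set" where
  "Qpoly k = {p. \<exists>c. p = (\<lambda>x. \<Sum>\<alpha> | \<forall>i. \<alpha> i \<le> k. c \<alpha> * (\<Prod>i\<in>UNIV. (x $ i) ^ \<alpha> i))}"

text \<open>
  A piecewise polynomial is given by the family of its restrictions to the cells, each one being
  represented by the unique polynomial on the whole space that extends it. So its trace on a
  face from a given cell is the value of the polynomial of that cell.
\<close>

type_synonym ('d, 'a) dgfun = "'d cell \<Rightarrow> real ^ 'd \<Rightarrow> 'a"

definition Mspace :: "'d::finite mesh \<Rightarrow> nat \<Rightarrow> ('d, real) dgfun set" where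
  "Mspace M k = {f. \<forall>K\<in>cells M. f K \<in> Qpoly k}"

definition Xspace :: "'d::finite mesh \<Rightarrow> nat \<Rightarrow> ('d, real ^ 'd) dgfun set" where
  "Xspace M k = {v. \<forall>l. (\<lambda>K x. v K x $ l) \<in> Mspace M k}"

type_synonym 'd state = "real \<times> (real ^ 'd) \<times> real"

abbreviation density :: "'d state \<Rightarrow> real" where "density W \<equiv> fst W"
abbreviation momentum :: "'d state \<Rightarrow> real ^ 'd" where "momentum W \<equiv> fst (snd W)"
abbreviation energy :: "'d state \<Rightarrow> real" where "energy W \<equiv> snd (snd W)"

abbreviation density_of :: "('d, 'd::finite state) dgfun \<Rightarrow> ('d, real) dgfun" where
  "density_of U \<equiv> (\<lambda>K x. density (U K x))"
abbreviation momentum_of :: "('d, 'd::finite state) dgfun \<Rightarrow> ('d, real ^ 'd) dgfun" where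
  "momentum_of U \<equiv> (\<lambda>K x. momentum (U K x))"
abbreviation energy_of :: "('d, 'd::finite state) dgfun \<Rightarrow> ('d, real) dgfun" where
  "energy_of U \<equiv> (\<lambda>K x. energy (U K x))"

definition state_space :: "'d::finite mesh \<Rightarrow> nat \<Rightarrow> ('d, 'd state) dgfun set" where
  "state_space M k =
     {U. density_of U \<in> Mspace M k \<and> momentum_of U \<in> Xspace M k \<and> energy_of U \<in> Mspace M k}"

definition trace_lower :: "'d face \<Rightarrow> ('d::finite, 'a) dgfun \<Rightarrow> real ^ 'd \<Rightarrow> 'a" where
  "trace_lower e v x = v (fst e) x"

definition trace_upper :: "'d::finite mesh \<Rightarrow> 'd face \<Rightarrow> ('d, 'a) dgfun \<Rightarrow> real ^ 'd \<Rightarrow> 'a" where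
  "trace_upper M e v x = v (next_cell M (snd e) (fst e)) (wrap M e x)"

definition trace_minus :: "'d::finite mesh \<Rightarrow> 'd face \<Rightarrow> ('d, 'a) dgfun \<Rightarrow> real ^ 'd \<Rightarrow> 'a" where
  "trace_minus M e v x = (if forward M e then trace_lower e v x else trace_upper M e v x)"

definition trace_plus :: "'d::finite mesh \<Rightarrow> 'd face \<Rightarrow> ('d, 'a) dgfun \<Rightarrow> real ^ 'd \<Rightarrow> 'a" where
  "trace_plus M e v x = (if forward M e then trace_upper M e v x else trace_lower e v x)"

definition face_normal :: "'d::finite mesh \<Rightarrow> 'd face \<Rightarrow> real ^ 'd" where
  "face_normal M e = (if forward M e then axis (snd e) 1 else - axis (snd e) 1)"

definition avg :: "'d::finite mesh \<Rightarrow> 'd face \<Rightarrow> ('d, 'a::real_vector) dgfun \<Rightarrow> real ^ 'd \<Rightarrow> 'a" where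
  "avg M e v x = (1/2) *\<^sub>R (trace_minus M e v x + trace_plus M e v x)"

definition jump :: "'d::finite mesh \<Rightarrow> 'd face \<Rightarrow> ('d, 'a::real_vector) dgfun \<Rightarrow> real ^ 'd \<Rightarrow> 'a" where
  "jump M e v x = trace_minus M e v x - trace_plus M e v x"

section \<open>Quadrature\<close>

text \<open>
  The nodes on the face \<open>(K, i)\<close> are given as points of \<open>K\<close>. The one rule of a face serves both
  adjacent cells.
\<close>

record ('d::finite) quadrature =
  cell_nodes :: "'d cell \<Rightarrow> (real ^ 'd) set"
  cell_weight :: "'d cell \<Rightarrow> real ^ 'd \<Rightarrow> real"
  face_nodes :: "'d face \<Rightarrow> (real ^ 'd) set"
  face_weight :: "'d face \<Rightarrow> real ^ 'd \<Rightarrow> real"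

definition wf_quadrature :: "'d::finite mesh \<Rightarrow> 'd quadrature \<Rightarrow> bool" where
  "wf_quadrature M Q \<longleftrightarrow>
     (\<forall>K\<in>cells M. finite (cell_nodes Q K) \<and> cell_nodes Q K \<subseteq> cell M K) \<and>
     (\<forall>e\<in>faces M. finite (face_nodes Q e) \<and> face_nodes Q e \<subseteq> face_set M e)"

definition cell_quad :: "'d::finite quadrature \<Rightarrow> 'd cell \<Rightarrow> (real ^ 'd \<Rightarrow> 'a::real_vector) \<Rightarrow> 'a" where
  "cell_quad Q K f = (\<Sum>x\<in>cell_nodes Q K. cell_weight Q K x *\<^sub>R f x)"

definition face_quad :: "'d::finite quadrature \<Rightarrow> 'd face \<Rightarrow> (real ^ 'd \<Rightarrow> 'a::real_vector) \<Rightarrow> 'a" where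
  "face_quad Q e f = (\<Sum>x\<in>face_nodes Q e. face_weight Q e x *\<^sub>R f x)"

definition exact_on_Qpoly :: "'d::finite mesh \<Rightarrow> 'd quadrature \<Rightarrow> nat \<Rightarrow> bool" where
  "exact_on_Qpoly M Q k \<longleftrightarrow>
     (\<forall>K\<in>cells M. \<forall>p\<in>Qpoly k. cell_quad Q K p = integral (cell M K) p)"

definition inner_quad ::
  "'d::finite mesh \<Rightarrow> 'd quadrature \<Rightarrow> ('d, 'a::real_inner) dgfun \<Rightarrow> ('d, 'a) dgfun \<Rightarrow> real" where
  "inner_quad M Q f g = (\<Sum>K\<in>cells M. cell_quad Q K (\<lambda>x. f K x \<bullet> g K x))"

section \<open>Hyperbolic subproblem\<close>

record params =
  gamma :: real
  reynolds :: real
  lam :: real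
  dt :: real
  sigma :: real
  sigma_tilde :: real
  eps :: real

definition velocity :: "'d::finite state \<Rightarrow> real ^ 'd" where
  "velocity W = momentum W /\<^sub>R density W"

definition internal_energy :: "'d::finite state \<Rightarrow> real" where
  "internal_energy W = energy W - (norm (momentum W))\<^sup>2 / (2 * density W)"

definition pressure :: "params \<Rightarrow> 'd::finite state \<Rightarrow> real" where
  "pressure P W = (gamma P - 1) * internal_energy W"

definition flux :: "params \<Rightarrow> 'd::finite state \<Rightarrow> (real ^ 'd) \<times> (real ^ 'd ^ 'd) \<times> (real ^ 'd)" where
  "flux P W =
     (density W *\<^sub>R velocity W,
      (\<chi> i j. density W * (velocity W $ i) * (velocity W $ j)) + mat (pressure P W),
      (energy W + pressure P W) *\<^sub>R velocity W)"

definition flux_dot ::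
  "(real ^ 'd::finite) \<times> (real ^ 'd ^ 'd) \<times> (real ^ 'd) \<Rightarrow> real ^ 'd \<Rightarrow> 'd state" where
  "flux_dot F v = (fst F \<bullet> v, fst (snd F) *v v, snd (snd F) \<bullet> v)"

definition grad :: "(real ^ 'd::finite \<Rightarrow> real) \<Rightarrow> real ^ 'd \<Rightarrow> real ^ 'd" where
  "grad p x = (\<chi> i. frechet_derivative p (at x) (axis i 1))"

definition wave_speed :: "params \<Rightarrow> real ^ 'd::finite \<Rightarrow> 'd state \<Rightarrow> real" where
  "wave_speed P n W = \<bar>velocity W \<bullet> n\<bar> + sqrt (gamma P * pressure P W / density W)"

text \<open>The maximum is taken over all points of the face, not just over the nodes.\<close>

definition alpha :: "'d::finite mesh \<Rightarrow> params \<Rightarrow> ('d, 'd state) dgfun \<Rightarrow> 'd face \<Rightarrow> real" where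
  "alpha M P U e =
     (SUP x\<in>face_set M e. max (wave_speed P (face_normal M e) (trace_minus M e U x))
                              (wave_speed P (face_normal M e) (trace_plus M e U x)))"

definition lax_friedrichs ::
  "params \<Rightarrow> real \<Rightarrow> real ^ 'd::finite \<Rightarrow> 'd state \<Rightarrow> 'd state \<Rightarrow> 'd state" where
  "lax_friedrichs P a n Win Wout =
     (1/2) *\<^sub>R flux_dot (flux P Win + flux P Wout) n - (a/2) *\<^sub>R (Wout - Win)"

text \<open>
  The boundary of \<open>K\<close> consists, for each direction \<open>i\<close>, of the face \<open>(K, i)\<close> with outward normal
  \<open>axis i 1\<close> and the face \<open>(prev_cell M i K, i)\<close> with outward normal \<open>- axis i 1\<close>. The nodes of
  the latter are points of the neighbour, whence the \<open>wrap\<close> in the argument of the test function.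
\<close>

definition boundary_term ::
  "'d::finite mesh \<Rightarrow> 'd quadrature \<Rightarrow> params \<Rightarrow> ('d, 'd state) dgfun \<Rightarrow> 'd cell
    \<Rightarrow> (real ^ 'd \<Rightarrow> real) \<Rightarrow> 'd state" where
  "boundary_term M Q P U K \<Psi> =
     (\<Sum>i\<in>UNIV.
        (let e = (K, i) in
           face_quad Q e (\<lambda>x. \<Psi> x *\<^sub>R
             lax_friedrichs P (alpha M P U e) (axis i 1) (trace_lower e U x) (trace_upper M e U x))) +
        (let e = (prev_cell M i K, i) in
           face_quad Q e (\<lambda>x. \<Psi> (wrap M e x) *\<^sub>R
             lax_friedrichs P (alpha M P U e) (- axis i 1) (trace_upper M e U x) (trace_lower e U x))))"

text \<open>
  \<open>R\<close> is a value of the semi-discrete operator at \<open>U\<close>. This is a relation because the mass matrix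
  of the quadrature rule may be singular.
\<close>

definition dg_operator ::
  "'d::finite mesh \<Rightarrow> nat \<Rightarrow> 'd quadrature \<Rightarrow> params \<Rightarrow> ('d, 'd state) dgfun \<Rightarrow> ('d, 'd state) dgfun
    \<Rightarrow> bool" where
  "dg_operator M k Q P U R \<longleftrightarrow>
     R \<in> state_space M k \<and>
     (\<forall>K\<in>cells M. \<forall>\<Psi>\<in>Qpoly k.
        cell_quad Q K (\<lambda>x. \<Psi> x *\<^sub>R R K x) =
        cell_quad Q K (\<lambda>x. flux_dot (flux P (U K x)) (grad \<Psi> x)) - boundary_term M Q P U K \<Psi>)"

section \<open>Limiter and Runge--Kutta method\<close>

definition admissible :: "real \<Rightarrow> 'd::finite state set" where
  "admissible \<epsilon> = {W. density W \<ge> \<epsilon> \<and> internal_energy W \<ge> \<epsilon>}"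

definition cell_average ::
  "'d::finite mesh \<Rightarrow> 'd cell \<Rightarrow> (real ^ 'd \<Rightarrow> 'a::euclidean_space) \<Rightarrow> 'a" where
  "cell_average M K f = integral (cell M K) f /\<^sub>R measure lborel (cell M K)"

definition limiter_factor :: "real \<Rightarrow> real \<Rightarrow> real \<Rightarrow> real" where
  "limiter_factor \<epsilon> a m = (if m \<ge> \<epsilon> then 1 else min 1 ((a - \<epsilon>) / (a - m)))"

definition limit_density ::
  "real \<Rightarrow> (real ^ 'd) set \<Rightarrow> 'd::finite state \<Rightarrow> (real ^ 'd \<Rightarrow> 'd state) \<Rightarrow> real ^ 'd \<Rightarrow> 'd state" where
  "limit_density \<epsilon> S A W x =
     (let \<theta> = limiter_factor \<epsilon> (density A) (Min ((\<lambda>y. density (W y)) ` S))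
      in (\<theta> * (density (W x) - density A) + density A, momentum (W x), energy (W x)))"

definition limit_energy ::
  "real \<Rightarrow> (real ^ 'd) set \<Rightarrow> 'd::finite state \<Rightarrow> (real ^ 'd \<Rightarrow> 'd state) \<Rightarrow> real ^ 'd \<Rightarrow> 'd state" where
  "limit_energy \<epsilon> S A W x =
     (let \<theta> = limiter_factor \<epsilon> (internal_energy A) (Min ((\<lambda>y. internal_energy (W y)) ` S))
      in \<theta> *\<^sub>R (W x - A) + A)"

definition limited ::
  "'d::finite mesh \<Rightarrow> ('d cell \<Rightarrow> (real ^ 'd) set) \<Rightarrow> params \<Rightarrow> ('d, 'd state) dgfun
    \<Rightarrow> ('d, 'd state) dgfun \<Rightarrow> bool" where
  "limited M S P U V \<longleftrightarrow>
     (\<forall>K\<in>cells M.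
        let A = cell_average M K (U K)
        in A \<in> admissible (eps P) \<and>
           V K = limit_energy (eps P) (S K) A (limit_density (eps P) (S K) A (U K)))"

definition rk_step ::
  "'d::finite mesh \<Rightarrow> nat \<Rightarrow> 'd quadrature \<Rightarrow> ('d cell \<Rightarrow> (real ^ 'd) set) \<Rightarrow> params \<Rightarrow> real
    \<Rightarrow> ('d, 'd state) dgfun \<Rightarrow> ('d, 'd state) dgfun \<Rightarrow> bool" where
  "rk_step M k Q S P \<tau> U V \<longleftrightarrow>
     (\<exists>R0 R1 R2 U1 U2.
        dg_operator M k Q P U R0 \<and>
        limited M S P (\<lambda>K x. U K x + \<tau> *\<^sub>R R0 K x) U1 \<and>
        dg_operator M k Q P U1 R1 \<and>
        limited M S P (\<lambda>K x. (3/4) *\<^sub>R U K x + (1/4) *\<^sub>R (U1 K x + \<tau> *\<^sub>R R1 K x)) U2 \<and>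
        dg_operator M k Q P U2 R2 \<and>
        limited M S P (\<lambda>K x. (1/3) *\<^sub>R U K x + (2/3) *\<^sub>R (U2 K x + \<tau> *\<^sub>R R2 K x)) V)"

section \<open>Parabolic forms\<close>

definition strain :: "(real ^ 'd::finite \<Rightarrow> real ^ 'd) \<Rightarrow> real ^ 'd \<Rightarrow> real ^ 'd ^ 'd" where
  "strain u x = (1/2) *\<^sub>R (jacobian u (at x) + transpose (jacobian u (at x)))"

definition divergence :: "(real ^ 'd::finite \<Rightarrow> real ^ 'd) \<Rightarrow> real ^ 'd \<Rightarrow> real" where
  "divergence u x = trace (jacobian u (at x))"

text \<open>The inner product of matrices below is the Frobenius product.\<close>

definition a_strain ::
  "'d::finite mesh \<Rightarrow> 'd quadrature \<Rightarrow> params \<Rightarrow> ('d, real ^ 'd) dgfun \<Rightarrow> ('d, real ^ 'd) dgfun \<Rightarrow> real" where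
  "a_strain M Q P u \<theta> =
     2 * (\<Sum>K\<in>cells M. cell_quad Q K (\<lambda>x. strain (u K) x \<bullet> strain (\<theta> K) x))
     - 2 * (\<Sum>e\<in>faces M. face_quad Q e
              (\<lambda>x. avg M e (\<lambda>K y. strain (u K) y *v face_normal M e) x \<bullet> jump M e \<theta> x))
     + 2 * (\<Sum>e\<in>faces M. face_quad Q e
              (\<lambda>x. avg M e (\<lambda>K y. strain (\<theta> K) y *v face_normal M e) x \<bullet> jump M e u x))
     + sigma P / mesh_size M * (\<Sum>e\<in>faces M. face_quad Q e (\<lambda>x. jump M e u x \<bullet> jump M e \<theta> x))"

definition a_div ::
  "'d::finite mesh \<Rightarrow> 'd quadrature \<Rightarrow> ('d, real ^ 'd) dgfun \<Rightarrow> ('d, real ^ 'd) dgfun \<Rightarrow> real" where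
  "a_div M Q u \<theta> =
     - (\<Sum>K\<in>cells M. cell_quad Q K (\<lambda>x. divergence (u K) x * divergence (\<theta> K) x))
     + (\<Sum>e\<in>faces M. face_quad Q e
          (\<lambda>x. avg M e (\<lambda>K. divergence (u K)) x * jump M e (\<lambda>K y. \<theta> K y \<bullet> face_normal M e) x))
     - (\<Sum>e\<in>faces M. face_quad Q e
          (\<lambda>x. avg M e (\<lambda>K. divergence (\<theta> K)) x * jump M e (\<lambda>K y. u K y \<bullet> face_normal M e) x))"

definition a_diffusion ::
  "'d::finite mesh \<Rightarrow> 'd quadrature \<Rightarrow> params \<Rightarrow> ('d, real) dgfun \<Rightarrow> ('d, real) dgfun \<Rightarrow> real" where
  "a_diffusion M Q P w \<phi> =
     (\<Sum>K\<in>cells M. cell_quad Q K (\<lambda>x. grad (w K) x \<bullet> grad (\<phi> K) x))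
     - (\<Sum>e\<in>faces M. face_quad Q e
          (\<lambda>x. avg M e (\<lambda>K y. grad (w K) y \<bullet> face_normal M e) x * jump M e \<phi> x))
     + sigma_tilde P / mesh_size M * (\<Sum>e\<in>faces M. face_quad Q e (\<lambda>x. jump M e w x * jump M e \<phi> x))"

definition b_strain ::
  "'d::finite mesh \<Rightarrow> 'd quadrature \<Rightarrow> params \<Rightarrow> ('d, real ^ 'd) dgfun \<Rightarrow> ('d, real) dgfun \<Rightarrow> real" where
  "b_strain M Q P u \<phi> =
     2 * (\<Sum>K\<in>cells M. cell_quad Q K (\<lambda>x. (strain (u K) x \<bullet> strain (u K) x) * \<phi> K x))
     + sigma P / mesh_size M *
         (\<Sum>e\<in>faces M. face_quad Q e (\<lambda>x. (jump M e u x \<bullet> jump M e u x) * avg M e \<phi> x))"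

definition b_div ::
  "'d::finite mesh \<Rightarrow> 'd quadrature \<Rightarrow> ('d, real ^ 'd) dgfun \<Rightarrow> ('d, real) dgfun \<Rightarrow> real" where
  "b_div M Q u \<phi> =
     - (\<Sum>K\<in>cells M. cell_quad Q K (\<lambda>x. divergence (u K) x * divergence (u K) x * \<phi> K x))"

section \<open>One time step\<close>

text \<open>
  The relation between the conserved variables \<open>(m, E)\<close> and the primitive variables \<open>(u, w)\<close>, for
  a given density; \<open>w\<close> is the specific internal energy.
\<close>

definition projected ::
  "'d::finite mesh \<Rightarrow> nat \<Rightarrow> 'd quadrature \<Rightarrow> ('d, real) dgfun
    \<Rightarrow> ('d, real ^ 'd) dgfun \<Rightarrow> ('d, real) dgfun \<Rightarrow> ('d, real ^ 'd) dgfun \<Rightarrow> ('d, real) dgfun \<Rightarrow> bool" where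
  "projected M k Q \<rho> m E u w \<longleftrightarrow>
     (\<forall>\<theta>\<in>Xspace M k. inner_quad M Q m \<theta> = inner_quad M Q (\<lambda>K x. \<rho> K x *\<^sub>R u K x) \<theta>) \<and>
     (\<forall>\<phi>\<in>Mspace M k.
        inner_quad M Q E \<phi> =
        inner_quad M Q (\<lambda>K x. \<rho> K x * w K x) \<phi> +
        1/2 * inner_quad M Q (\<lambda>K x. \<rho> K x *\<^sub>R u K x) (\<lambda>K x. \<phi> K x *\<^sub>R u K x))"

definition parabolic_step ::
  "'d::finite mesh \<Rightarrow> nat \<Rightarrow> 'd quadrature \<Rightarrow> ('d cell \<Rightarrow> (real ^ 'd) set) \<Rightarrow> params
    \<Rightarrow> ('d, 'd state) dgfun \<Rightarrow> ('d, 'd state) dgfun \<Rightarrow> bool" where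
  "parabolic_step M k Q S P UH V \<longleftrightarrow>
     (\<exists>uH wH us uP wP mP EP \<rho>.
        \<rho> = density_of UH \<and>
        uH \<in> Xspace M k \<and> wH \<in> Mspace M k \<and>
        projected M k Q \<rho> (momentum_of UH) (energy_of UH) uH wH \<and>
        us \<in> Xspace M k \<and>
        (\<forall>\<theta>\<in>Xspace M k.
           inner_quad M Q (\<lambda>K x. \<rho> K x *\<^sub>R us K x) \<theta>
           + dt P / (2 * reynolds P) * a_strain M Q P us \<theta>
           + dt P / (3 * reynolds P) * a_div M Q us \<theta> =
           inner_quad M Q (\<lambda>K x. \<rho> K x *\<^sub>R uH K x) \<theta>) \<and>
        uP = (\<lambda>K x. 2 *\<^sub>R us K x - uH K x) \<and>
        wP \<in> Mspace M k \<and>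
        (\<forall>\<phi>\<in>Mspace M k.
           inner_quad M Q (\<lambda>K x. \<rho> K x * wP K x) \<phi>
           + dt P * lam P / reynolds P * a_diffusion M Q P wP \<phi> =
           inner_quad M Q (\<lambda>K x. \<rho> K x * wH K x) \<phi>
           + dt P / reynolds P * b_strain M Q P us \<phi>
           + 2 * dt P / (3 * reynolds P) * b_div M Q us \<phi>) \<and>
        mP \<in> Xspace M k \<and> EP \<in> Mspace M k \<and>
        projected M k Q \<rho> mP EP uP wP \<and>
        limited M S P (\<lambda>K x. (\<rho> K x, mP K x, EP K x)) V)"

definition time_step ::
  "'d::finite mesh \<Rightarrow> nat \<Rightarrow> 'd quadrature \<Rightarrow> 'd quadrature \<Rightarrow> ('d cell \<Rightarrow> (real ^ 'd) set) \<Rightarrow> params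
    \<Rightarrow> ('d, 'd state) dgfun \<Rightarrow> ('d, 'd state) dgfun \<Rightarrow> bool" where
  "time_step M k QH QP S P U V \<longleftrightarrow>
     (\<exists>UH UP. rk_step M k QH S P (dt P / 2) U UH \<and>
              parabolic_step M k QP S P UH UP \<and>
              rk_step M k QH S P (dt P / 2) UP V)"

end

theory Submission
  imports Defs
begin

text \<open>
  The quantity that every substep leaves unchanged is the exact integral of the piecewise polynomial
  state over the whole box, \<open>mass\<close>. It connects the ingredients of the scheme: the limiter
  rescales around exact cell averages and so preserves the exact integral in each cell, whereas
  the discrete equations only speak about quadrature sums. Exactness on
  degree \<open>k\<close> identifies the two for every rule in use (\<open>inner_quad_eq_mass\<close>). So it is harmless that the
  two subproblems use different rules.

  Hyperbolic substep: testing with \<open>\<Psi> = 1\<close> leaves only the face terms. Each face is met once from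
  either side, and the Lax--Friedrichs flux changes sign when the normal and the two traces are
  swapped, so the face terms cancel over a periodic mesh (\<open>sum_boundary_term\<close>).
  Every Runge--Kutta stage is a convex combination of states of equal mass plus a multiple of a
  value of the operator, whose mass is zero.

  Parabolic substep: all forms vanish when tested with a constant, which gives the balance of
  momentum. For the total energy, the viscous work lost as kinetic energy must reappear as
  heat. The viscous forms are nonsymmetric and satisfy \<open>a(u, u) = b(u, 1)\<close>, since the two
  consistency terms cancel on the diagonal. The velocity update is a midpoint rule
  \<open>u\<^sup>P = 2 u\<^sup>* - u\<^sup>H\<close>, so the change of the kinetic energy is exactly
  \<open>\<langle>\<rho> u\<^sup>P, u\<^sup>P\<rangle>/2 - \<langle>\<rho> u\<^sup>H, u\<^sup>H\<rangle>/2 = 2 \<langle>\<rho> (u\<^sup>* - u\<^sup>H), u\<^sup>*\<rangle>\<close>, which is the momentum equation tested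
  with \<open>2 u\<^sup>*\<close>. No quadrature error enters, because the same sums occur on both sides.
\<close>

section \<open>Cells and piecewise polynomials\<close>

lemma finite_bounded_multi_indices: "finite {\<alpha> :: 'd::finite \<Rightarrow> nat. \<forall>i. \<alpha> i \<le> n i}"
proof -
  have "{\<alpha>. \<forall>i. \<alpha> i \<le> n i} = PiE UNIV (\<lambda>i. {..n i})"
    by (auto simp: PiE_def Pi_def)
  then show ?thesis
    by (simp add: finite_PiE)
qed

lemma content_cell_pos:
  assumes "wf_mesh M"
  shows "measure lborel (cell M K) > 0"
  using assms unfolding cell_def wf_mesh_def
  by (intro content_pos_lt) (auto simp: Basis_vec_def inner_axis inner_add_left)

lemma Qpoly_const: "(\<lambda>x :: real ^ 'd::finite. c) \<in> Qpoly k"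
proof -
  let ?A = "{\<alpha> :: 'd \<Rightarrow> nat. \<forall>i. \<alpha> i \<le> k}"
  have "(\<Sum>\<alpha>\<in>?A. (if \<alpha> = (\<lambda>_. 0) then c else 0) * (\<Prod>i\<in>UNIV. (x $ i) ^ \<alpha> i)) = c"
    for x :: "real ^ 'd"
  proof -
    have "(\<Sum>\<alpha>\<in>?A. (if \<alpha> = (\<lambda>_. 0) then c else 0) * (\<Prod>i\<in>UNIV. (x $ i) ^ \<alpha> i))
        = (\<Sum>\<alpha>\<in>?A. if \<alpha> = (\<lambda>_. 0) then c else 0)"
      by (intro sum.cong) auto
    also have "\<dots> = c"
      using finite_bounded_multi_indices[of "\<lambda>_ :: 'd. k"] by (simp add: sum.delta)
    finally show ?thesis .
  qed
  then show ?thesis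
    unfolding Qpoly_def by (intro CollectI exI[of _ "\<lambda>\<alpha>. if \<alpha> = (\<lambda>_. 0) then c else 0"]) auto
qed

lemma Qpoly_add:
  assumes "p \<in> Qpoly k" "q \<in> Qpoly k"
  shows "(\<lambda>x. p x + q x) \<in> Qpoly k"
proof -
  obtain c d where
    "p = (\<lambda>x. \<Sum>\<alpha> | \<forall>i. \<alpha> i \<le> k. c \<alpha> * (\<Prod>i\<in>UNIV. (x $ i) ^ \<alpha> i))"
    "q = (\<lambda>x. \<Sum>\<alpha> | \<forall>i. \<alpha> i \<le> k. d \<alpha> * (\<Prod>i\<in>UNIV. (x $ i) ^ \<alpha> i))"
    using assms by (auto simp: Qpoly_def)
  then show ?thesis
    unfolding Qpoly_def
    by (intro CollectI exI[of _ "\<lambda>\<alpha>. c \<alpha> + d \<alpha>"]) (simp add: sum.distrib algebra_simps)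
qed

lemma Qpoly_scale:
  assumes "p \<in> Qpoly k"
  shows "(\<lambda>x. a * p x) \<in> Qpoly k"
proof -
  obtain c where "p = (\<lambda>x. \<Sum>\<alpha> | \<forall>i. \<alpha> i \<le> k. c \<alpha> * (\<Prod>i\<in>UNIV. (x $ i) ^ \<alpha> i))"
    using assms by (auto simp: Qpoly_def)
  then show ?thesis
    unfolding Qpoly_def
    by (intro CollectI exI[of _ "\<lambda>\<alpha>. a * c \<alpha>"]) (simp add: sum_distrib_left algebra_simps)
qed

lemma Qpoly_affine:
  assumes "p \<in> Qpoly k"
  shows "(\<lambda>x. \<theta> * (p x - a) + b) \<in> Qpoly k"
  using Qpoly_add[OF Qpoly_scale[OF assms, of \<theta>] Qpoly_const[of "b - \<theta> * a"]]
  by (simp add: algebra_simps)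

lemma continuous_on_Qpoly: "p \<in> Qpoly k \<Longrightarrow> continuous_on T p"
  by (auto simp: Qpoly_def intro!: continuous_intros)

lemma state_space_component:
  assumes "U \<in> state_space M k" "K \<in> cells M"
  shows "(\<lambda>x. density (U K x)) \<in> Qpoly k"
    and "(\<lambda>x. momentum (U K x) $ l) \<in> Qpoly k"
    and "(\<lambda>x. energy (U K x)) \<in> Qpoly k"
  using assms by (auto simp: state_space_def Mspace_def Xspace_def)

lemma state_space_add:
  assumes "U \<in> state_space M k" "V \<in> state_space M k"
  shows "(\<lambda>K x. U K x + V K x) \<in> state_space M k"
  using assms by (auto simp: state_space_def Mspace_def Xspace_def intro!: Qpoly_add)

lemma state_space_scale:
  assumes "U \<in> state_space M k"
  shows "(\<lambda>K x. a *\<^sub>R U K x) \<in> state_space M k"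
  using assms by (auto simp: state_space_def Mspace_def Xspace_def intro!: Qpoly_scale)

lemma continuous_on_state:
  assumes "U \<in> state_space M k" "K \<in> cells M"
  shows "continuous_on T (U K)"
proof -
  have "continuous_on T (\<lambda>x. (density (U K x), \<chi> l. momentum (U K x) $ l, energy (U K x)))"
    by (intro continuous_on_Pair continuous_on_vec_lambda continuous_on_Qpoly[where k = k]
        state_space_component[OF assms])
  then show ?thesis
    by simp
qed

lemma integrable_state:
  assumes "U \<in> state_space M k" "K \<in> cells M"
  shows "U K integrable_on cell M K"
  unfolding cell_def by (intro integrable_continuous continuous_on_state[OF assms])

section \<open>Conserved integrals and their quadrature\<close>

definition mass :: "'d::finite mesh \<Rightarrow> ('d, 'd state) dgfun \<Rightarrow> 'd state" where
  "mass M U = (\<Sum>K\<in>cells M. integral (cell M K) (U K))"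

lemma mass_add:
  assumes "U \<in> state_space M k" "V \<in> state_space M k"
  shows "mass M (\<lambda>K x. U K x + V K x) = mass M U + mass M V"
  unfolding mass_def sum.distrib[symmetric]
  by (intro sum.cong refl integral_add integrable_state[OF assms(1)] integrable_state[OF assms(2)])

lemma mass_scale: "mass M (\<lambda>K x. a *\<^sub>R U K x) = a *\<^sub>R mass M U"
  by (simp add: mass_def scaleR_sum_right)

lemma integral_state_component:
  assumes "W integrable_on T"
  shows "density (integral T W) = integral T (\<lambda>x. density (W x))"
    and "momentum (integral T W) $ l = integral T (\<lambda>x. momentum (W x) $ l)"
    and "momentum (integral T W) = integral T (\<lambda>x. momentum (W x))"
    and "energy (integral T W) = integral T (\<lambda>x. energy (W x))"
proof -
  have "bounded_linear (\<lambda>W. momentum W)" "bounded_linear (\<lambda>W. energy W)"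
    by (intro bounded_linear_compose[OF bounded_linear_fst bounded_linear_snd]
        bounded_linear_compose[OF bounded_linear_snd bounded_linear_snd])+
  moreover have "bounded_linear (\<lambda>W. momentum W $ l)"
    by (intro bounded_linear_compose[OF bounded_linear_vec_nth] calculation)
  ultimately show "density (integral T W) = integral T (\<lambda>x. density (W x))"
    "momentum (integral T W) $ l = integral T (\<lambda>x. momentum (W x) $ l)"
    "momentum (integral T W) = integral T (\<lambda>x. momentum (W x))"
    "energy (integral T W) = integral T (\<lambda>x. energy (W x))"
    using integral_linear[OF assms] bounded_linear_fst by (force simp: o_def)+
qed

lemma cell_quad_state_component:
  "density (cell_quad Q K W) = cell_quad Q K (\<lambda>x. density (W x))"
  "momentum (cell_quad Q K W) $ l = cell_quad Q K (\<lambda>x. momentum (W x) $ l)"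
  "energy (cell_quad Q K W) = cell_quad Q K (\<lambda>x. energy (W x))"
  by (simp_all add: cell_quad_def fst_sum snd_sum)

lemma cell_quad_state_exact:
  assumes "exact_on_Qpoly M Q k" "U \<in> state_space M k" "K \<in> cells M"
  shows "cell_quad Q K (U K) = integral (cell M K) (U K)"
proof -
  have "cell_quad Q K p = integral (cell M K) p" if "p \<in> Qpoly k" for p
    using assms that by (auto simp: exact_on_Qpoly_def)
  then show ?thesis
    using state_space_component[OF assms(2,3)]
    by (auto simp: prod_eq_iff vec_eq_iff cell_quad_state_component
        integral_state_component(1,2,4)[OF integrable_state[OF assms(2,3)]])
qed

lemma inner_quad_eq_mass:
  assumes "exact_on_Qpoly M Q k" "U \<in> state_space M k"
  shows "inner_quad M Q (density_of U) (\<lambda>K x. 1) = density (mass M U)"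
    and "inner_quad M Q (\<lambda>K x. momentum_of U K x $ l) (\<lambda>K x. 1) = momentum (mass M U) $ l"
    and "inner_quad M Q (energy_of U) (\<lambda>K x. 1) = energy (mass M U)"
proof -
  have "mass M U = (\<Sum>K\<in>cells M. cell_quad Q K (U K))"
    unfolding mass_def using cell_quad_state_exact[OF assms] by simp
  then show "inner_quad M Q (density_of U) (\<lambda>K x. 1) = density (mass M U)"
    "inner_quad M Q (\<lambda>K x. momentum_of U K x $ l) (\<lambda>K x. 1) = momentum (mass M U) $ l"
    "inner_quad M Q (energy_of U) (\<lambda>K x. 1) = energy (mass M U)"
    by (simp_all add: inner_quad_def fst_sum snd_sum cell_quad_state_component)
qed

section \<open>Limiter\<close>

lemma integral_rescaled_around_average:
  fixes f :: "real ^ 'd::finite \<Rightarrow> 'a::euclidean_space"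
  assumes "wf_mesh M" "f integrable_on cell M K"
  shows "integral (cell M K) (\<lambda>x. \<theta> *\<^sub>R (f x - cell_average M K f) + cell_average M K f)
    = integral (cell M K) f"
proof -
  have const: "(\<lambda>x. c) integrable_on cell M K"
      "integral (cell M K) (\<lambda>x. c) = measure lborel (cell M K) *\<^sub>R c" for c :: 'a
    unfolding cell_def by (auto intro: integrable_const)
  have "measure lborel (cell M K) *\<^sub>R cell_average M K f = integral (cell M K) f"
    using content_cell_pos[OF assms(1), of K] by (simp add: cell_average_def)
  then show ?thesis
    using const assms(2)
    by (simp add: integral_add integral_diff integrable_diff integrable_cmul)
qed

text \<open>
  The first stage of the limiter changes only the density and does not move the cell average, so
  the second stage, which is set up with the average of the original state, again rescales around
  the average of its own argument.
\<close>

lemma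
  assumes "wf_mesh M" "U \<in> state_space M k" "limited M S P U V"
  shows limited_state_space: "V \<in> state_space M k"
    and mass_limited: "mass M V = mass M U"
proof -
  define A where "A = (\<lambda>K. cell_average M K (U K))"
  define W where "W = (\<lambda>K. limit_density (eps P) (S K) (A K) (U K))"
  have V: "V K = limit_energy (eps P) (S K) (A K) (W K)" if "K \<in> cells M" for K
    using assms(3) that by (simp add: limited_def A_def W_def Let_def)
  have W_space: "W \<in> state_space M k"
    using assms(2)
    by (auto simp: state_space_def Mspace_def Xspace_def W_def limit_density_def Let_def
        intro!: Qpoly_affine)
  then show "V \<in> state_space M k"
    using V
    by (auto simp: state_space_def Mspace_def Xspace_def limit_energy_def Let_def
        intro!: Qpoly_affine)
  have "integral (cell M K) (V K) = integral (cell M K) (U K)" if K: "K \<in> cells M" for K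
  proof -
    have U_int: "U K integrable_on cell M K" and W_int: "W K integrable_on cell M K"
      using integrable_state assms(2) W_space K by blast+
    have dens_int: "(\<lambda>x. density (U K x)) integrable_on cell M K"
      using integrable_linear[OF U_int bounded_linear_fst] by (simp add: o_def)
    have dens_A: "density (A K) = cell_average M K (\<lambda>x. density (U K x))"
      by (simp add: A_def cell_average_def integral_state_component[OF U_int])
    have "integral (cell M K) (\<lambda>x. density (W K x)) = integral (cell M K) (\<lambda>x. density (U K x))"
      using integral_rescaled_around_average[OF assms(1) dens_int]
      by (simp add: W_def limit_density_def Let_def dens_A)
    then have W_integral: "integral (cell M K) (W K) = integral (cell M K) (U K)"
      by (simp add: prod_eq_iff integral_state_component[OF U_int]
          integral_state_component[OF W_int]) (simp add: W_def limit_density_def Let_def)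
    then have A_W: "A K = cell_average M K (W K)"
      by (simp add: A_def cell_average_def)
    obtain \<theta> where "V K = (\<lambda>x. \<theta> *\<^sub>R (W K x - A K) + A K)"
      using V[OF K] unfolding limit_energy_def[abs_def] Let_def by blast
    then have "integral (cell M K) (V K) = integral (cell M K) (W K)"
      by (simp add: A_W integral_rescaled_around_average[OF assms(1) W_int])
    with W_integral show ?thesis
      by simp
  qed
  then show "mass M V = mass M U"
    by (simp add: mass_def)
qed

section \<open>Hyperbolic substep\<close>

lemma bij_betw_prev_cell:
  fixes M :: "'d::finite mesh"
  assumes "wf_mesh M"
  shows "bij_betw (prev_cell M i) (cells M) (cells M)"
proof (rule bij_betw_byWitness[where f' = "next_cell M i"])
  have pos: "ncells M j > 0" for j
    using assms by (simp add: wf_mesh_def Suc_le_eq)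
  show "\<forall>K\<in>cells M. next_cell M i (prev_cell M i K) = K"
    using pos[of i] by (auto simp: cells_def next_cell_def prev_cell_def fun_eq_iff)
      (metis less_irrefl)
  show "\<forall>K\<in>cells M. prev_cell M i (next_cell M i K) = K"
    using pos by (auto simp: cells_def next_cell_def prev_cell_def fun_eq_iff)
  show "prev_cell M i ` cells M \<subseteq> cells M"
    using pos by (auto simp: cells_def prev_cell_def less_imp_diff_less)
  show "next_cell M i ` cells M \<subseteq> cells M"
    using pos by (auto simp: cells_def next_cell_def Suc_lessI)
qed

lemma flux_dot_minus_right: "flux_dot F (- n) = - flux_dot F n"
  by (simp add: flux_dot_def matrix_vector_mult_def vec_eq_iff sum_negf)

lemma flux_dot_zero_right: "flux_dot F 0 = 0"
  by (simp add: flux_dot_def zero_prod_def)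

lemma lax_friedrichs_conservative:
  "lax_friedrichs P a (- n) W' W = - lax_friedrichs P a n W W'"
  by (simp add: lax_friedrichs_def flux_dot_minus_right add.commute algebra_simps)

lemma grad_const: "grad (\<lambda>x. c) x = 0"
  by (simp add: grad_def vec_eq_iff)

text \<open>
  Summation by parts on the torus: the flux that leaves a cell through its upper face \<open>(K, i)\<close> enters
  \<open>next_cell M i K\<close>, and stepping back by one cell permutes the cells of a periodic mesh.
\<close>

lemma sum_boundary_term:
  fixes M :: "'d::finite mesh"
  assumes "wf_mesh M"
  shows "(\<Sum>K\<in>cells M. boundary_term M Q P U K (\<lambda>x. 1)) = 0"
proof -
  define F where "F e = face_quad Q e (\<lambda>x. lax_friedrichs P (alpha M P U e) (axis (snd e) 1)
      (trace_lower e U x) (trace_upper M e U x))" for e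
  have "boundary_term M Q P U K (\<lambda>x. 1) = (\<Sum>i\<in>UNIV. F (K, i) - F (prev_cell M i K, i))" for K
    by (simp add: boundary_term_def F_def Let_def lax_friedrichs_conservative face_quad_def
        sum_negf)
  then have "(\<Sum>K\<in>cells M. boundary_term M Q P U K (\<lambda>x. 1))
      = (\<Sum>i\<in>UNIV. (\<Sum>K\<in>cells M. F (K, i)) - (\<Sum>K\<in>cells M. F (prev_cell M i K, i)))"
    by (simp add: sum.swap[of _ UNIV] sum_subtractf)
  also have "\<dots> = 0"
    using sum.reindex_bij_betw[OF bij_betw_prev_cell[OF assms], of "\<lambda>K. F (K, i)" i for i]
    by simp
  finally show ?thesis .
qed

lemma mass_dg_operator:
  assumes "wf_mesh M" "exact_on_Qpoly M Q k" "dg_operator M k Q P U R"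
  shows "mass M R = 0"
proof -
  have R: "R \<in> state_space M k"
    using assms(3) by (simp add: dg_operator_def)
  have "cell_quad Q K (R K) = - boundary_term M Q P U K (\<lambda>x. 1)" if K: "K \<in> cells M" for K
  proof -
    have "\<forall>\<Psi>\<in>Qpoly k. cell_quad Q K (\<lambda>x. \<Psi> x *\<^sub>R R K x)
        = cell_quad Q K (\<lambda>x. flux_dot (flux P (U K x)) (grad \<Psi> x)) - boundary_term M Q P U K \<Psi>"
      using assms(3) K by (simp add: dg_operator_def)
    from bspec[OF this Qpoly_const[of 1]] show ?thesis
      by (simp add: grad_const flux_dot_zero_right cell_quad_def)
  qed
  then have "mass M R = - (\<Sum>K\<in>cells M. boundary_term M Q P U K (\<lambda>x. 1))"
    unfolding mass_def by (simp add: cell_quad_state_exact[OF assms(2) R, symmetric] sum_negf)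
  then show ?thesis
    by (simp add: sum_boundary_term[OF assms(1)])
qed

lemma
  assumes "wf_mesh M" "exact_on_Qpoly M Q k" "U \<in> state_space M k" "rk_step M k Q S P \<tau> U V"
  shows rk_step_state_space: "V \<in> state_space M k"
    and mass_rk_step: "mass M V = mass M U"
proof -
  obtain R0 R1 R2 U1 U2 where
    R0: "dg_operator M k Q P U R0" and
    U1: "limited M S P (\<lambda>K x. U K x + \<tau> *\<^sub>R R0 K x) U1" and
    R1: "dg_operator M k Q P U1 R1" and
    U2: "limited M S P (\<lambda>K x. (3/4) *\<^sub>R U K x + (1/4) *\<^sub>R (U1 K x + \<tau> *\<^sub>R R1 K x)) U2" and
    R2: "dg_operator M k Q P U2 R2" and
    V: "limited M S P (\<lambda>K x. (1/3) *\<^sub>R U K x + (2/3) *\<^sub>R (U2 K x + \<tau> *\<^sub>R R2 K x)) V"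
    using assms(4) unfolding rk_step_def by blast
  have euler: "(\<lambda>K x. W K x + \<tau> *\<^sub>R R K x) \<in> state_space M k"
      "mass M (\<lambda>K x. W K x + \<tau> *\<^sub>R R K x) = mass M W"
    if "W \<in> state_space M k" "dg_operator M k Q P W' R" for W W' R
  proof -
    have "R \<in> state_space M k"
      using that(2) by (simp add: dg_operator_def)
    then show "(\<lambda>K x. W K x + \<tau> *\<^sub>R R K x) \<in> state_space M k"
      "mass M (\<lambda>K x. W K x + \<tau> *\<^sub>R R K x) = mass M W"
      using that(1) mass_dg_operator[OF assms(1,2) that(2)]
      by (simp_all add: state_space_add state_space_scale mass_add mass_scale)
  qed
  have combine: "(\<lambda>K x. a *\<^sub>R U K x + b *\<^sub>R W K x) \<in> state_space M k"
      "mass M (\<lambda>K x. a *\<^sub>R U K x + b *\<^sub>R W K x) = mass M U"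
    if "W \<in> state_space M k" "mass M W = mass M U" "a + b = 1" for a b W
    using that(2,3)
    by (simp_all add: state_space_add[OF state_space_scale[OF assms(3)] state_space_scale[OF that(1)]]
        mass_add[OF state_space_scale[OF assms(3)] state_space_scale[OF that(1)]] mass_scale
        scaleR_add_left[symmetric])
  have U1': "U1 \<in> state_space M k" "mass M U1 = mass M U"
    using limited_state_space[OF assms(1) _ U1] mass_limited[OF assms(1) _ U1]
      euler[OF assms(3) R0] by simp_all
  have U2': "U2 \<in> state_space M k" "mass M U2 = mass M U"
    using limited_state_space[OF assms(1) _ U2] mass_limited[OF assms(1) _ U2]
      combine[OF euler(1)[OF U1'(1) R1], of "3/4" "1/4"] euler(2)[OF U1'(1) R1] U1'(2)
    by simp_all
  show "V \<in> state_space M k" "mass M V = mass M U"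
    using limited_state_space[OF assms(1) _ V] mass_limited[OF assms(1) _ V]
      combine[OF euler(1)[OF U2'(1) R2], of "1/3" "2/3"] euler(2)[OF U2'(1) R2] U2'(2)
    by simp_all
qed

section \<open>Parabolic forms\<close>

lemma jacobian_const: "jacobian (\<lambda>x. c) (at x) = 0"
  by (simp add: jacobian_def matrix_def vec_eq_iff)

lemma strain_const: "strain (\<lambda>x. c) x = 0"
  by (simp add: strain_def jacobian_const transpose_def vec_eq_iff)

lemma divergence_const: "divergence (\<lambda>x. c) = (\<lambda>x. 0)"
  by (simp add: divergence_def jacobian_const trace_def fun_eq_iff)

lemma jump_const: "jump M e (\<lambda>K x. c) x = 0"
  by (simp add: jump_def trace_minus_def trace_plus_def trace_lower_def trace_upper_def)

lemma avg_const: "avg M e (\<lambda>K x. c) x = c"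
  by (simp add: avg_def trace_minus_def trace_plus_def trace_lower_def trace_upper_def
      scaleR_2[symmetric])

lemma a_strain_const: "a_strain M Q P u (\<lambda>K x. c) = 0"
  by (simp add: a_strain_def strain_const jump_const avg_const cell_quad_def face_quad_def)

lemma a_div_const: "a_div M Q u (\<lambda>K x. c) = 0"
  by (simp add: a_div_def divergence_const jump_const avg_const cell_quad_def face_quad_def)

lemma a_diffusion_const: "a_diffusion M Q P w (\<lambda>K x. c) = 0"
  by (simp add: a_diffusion_def grad_const jump_const cell_quad_def face_quad_def)

text \<open>
  The form \<open>a_strain\<close> is nonsymmetric (the consistency and the adjoint term have opposite signs), so
  on the diagonal only the terms that also make up the viscous heating remain; likewise for
  \<open>a_div\<close>.
\<close>

lemma a_strain_diagonal: "a_strain M Q P u u = b_strain M Q P u (\<lambda>K x. 1)"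
  by (simp add: a_strain_def b_strain_def avg_const)

lemma a_div_diagonal: "a_div M Q u u = b_div M Q u (\<lambda>K x. 1)"
  by (simp add: a_div_def b_div_def)

section \<open>Parabolic substep\<close>

lemma inner_quad_axis:
  "inner_quad M Q m (\<lambda>K x. axis l 1) = inner_quad M Q (\<lambda>K x. m K x $ l) (\<lambda>K x. 1)"
  by (simp add: inner_quad_def inner_axis)

lemma inner_quad_extrapolated:
  "inner_quad M Q (\<lambda>K x. \<rho> K x *\<^sub>R (2 *\<^sub>R v K x - u K x)) \<theta>
    = 2 * inner_quad M Q (\<lambda>K x. \<rho> K x *\<^sub>R v K x) \<theta> - inner_quad M Q (\<lambda>K x. \<rho> K x *\<^sub>R u K x) \<theta>"
  unfolding inner_quad_def cell_quad_def sum_distrib_left sum_subtractf[symmetric]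
  by (intro sum.cong refl) (simp add: algebra_simps)

text \<open>
  The difference on the right is what the momentum equation tested with \<open>v = u\<^sup>*\<close> expresses through the
  viscous forms. For \<open>\<rho> = 1\<close> this is \<open>|2v - u|\<^sup>2 = |u|\<^sup>2 + 4 (v - u) \<bullet> v\<close>.
\<close>

lemma kinetic_energy_extrapolated:
  fixes u v :: "('d::finite, real ^ 'd) dgfun"
  shows "inner_quad M Q (\<lambda>K x. \<rho> K x *\<^sub>R (2 *\<^sub>R v K x - u K x)) (\<lambda>K x. 2 *\<^sub>R v K x - u K x)
    = inner_quad M Q (\<lambda>K x. \<rho> K x *\<^sub>R u K x) u
      + 4 * (inner_quad M Q (\<lambda>K x. \<rho> K x *\<^sub>R v K x) v - inner_quad M Q (\<lambda>K x. \<rho> K x *\<^sub>R u K x) v)"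
  unfolding inner_quad_def cell_quad_def sum_distrib_left sum_subtractf[symmetric]
    sum.distrib[symmetric]
  by (intro sum.cong refl) (simp add: algebra_simps inner_commute)

lemma Xspace_const: "(\<lambda>K x. c) \<in> Xspace M k"
  by (simp add: Xspace_def Mspace_def Qpoly_const)

lemma Mspace_const: "(\<lambda>K x. c) \<in> Mspace M k"
  by (simp add: Mspace_def Qpoly_const)

lemma
  assumes "wf_mesh M" "exact_on_Qpoly M Q k" "U \<in> state_space M k"
    and "parabolic_step M k Q S P U V"
  shows parabolic_step_state_space: "V \<in> state_space M k"
    and mass_parabolic_step: "mass M V = mass M U"
proof -
  define \<rho> where "\<rho> = density_of U"
  obtain uH wH us uP wP mP EP where
    uwH: "projected M k Q \<rho> (momentum_of U) (energy_of U) uH wH" and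
    us: "us \<in> Xspace M k" and
    us_eq: "\<And>\<theta>. \<theta> \<in> Xspace M k \<Longrightarrow>
       inner_quad M Q (\<lambda>K x. \<rho> K x *\<^sub>R us K x) \<theta>
       + dt P / (2 * reynolds P) * a_strain M Q P us \<theta>
       + dt P / (3 * reynolds P) * a_div M Q us \<theta> =
       inner_quad M Q (\<lambda>K x. \<rho> K x *\<^sub>R uH K x) \<theta>" and
    uP: "uP = (\<lambda>K x. 2 *\<^sub>R us K x - uH K x)" and
    wP_eq: "\<And>\<phi>. \<phi> \<in> Mspace M k \<Longrightarrow>
       inner_quad M Q (\<lambda>K x. \<rho> K x * wP K x) \<phi>
       + dt P * lam P / reynolds P * a_diffusion M Q P wP \<phi> =
       inner_quad M Q (\<lambda>K x. \<rho> K x * wH K x) \<phi>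
       + dt P / reynolds P * b_strain M Q P us \<phi>
       + 2 * dt P / (3 * reynolds P) * b_div M Q us \<phi>" and
    mP: "mP \<in> Xspace M k" and EP: "EP \<in> Mspace M k" and
    uwP: "projected M k Q \<rho> mP EP uP wP" and
    V: "limited M S P (\<lambda>K x. (\<rho> K x, mP K x, EP K x)) V"
    using assms(4) unfolding parabolic_step_def \<rho>_def by blast
  define W where "W = (\<lambda>K x. (\<rho> K x, mP K x, EP K x))"
  have W: "W \<in> state_space M k"
    using assms(3) mP EP by (simp add: state_space_def W_def \<rho>_def)
  have momentum: "inner_quad M Q (\<lambda>K x. mP K x $ l) (\<lambda>K x. 1)
      = inner_quad M Q (\<lambda>K x. momentum_of U K x $ l) (\<lambda>K x. 1)" for l
  proof -
    let ?\<theta> = "\<lambda>(K :: 'a cell) (x :: real ^ 'a). axis l 1 :: real ^ 'a"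
    have "inner_quad M Q mP ?\<theta> = inner_quad M Q (\<lambda>K x. \<rho> K x *\<^sub>R uP K x) ?\<theta>"
      using uwP Xspace_const[of "axis l 1" M k] by (simp add: projected_def)
    also have "\<dots> = inner_quad M Q (\<lambda>K x. \<rho> K x *\<^sub>R uH K x) ?\<theta>"
      using us_eq[OF Xspace_const[of "axis l 1"]]
      by (simp add: uP inner_quad_extrapolated a_strain_const a_div_const)
    also have "\<dots> = inner_quad M Q (momentum_of U) ?\<theta>"
      using uwH Xspace_const[of "axis l 1" M k] by (simp add: projected_def)
    finally show ?thesis
      by (simp add: inner_quad_axis)
  qed
  have energy: "inner_quad M Q EP (\<lambda>K x. 1) = inner_quad M Q (energy_of U) (\<lambda>K x. 1)"
  proof -
    have total: "inner_quad M Q E (\<lambda>K x. 1) = inner_quad M Q (\<lambda>K x. \<rho> K x * w K x) (\<lambda>K x. 1)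
        + 1/2 * inner_quad M Q (\<lambda>K x. \<rho> K x *\<^sub>R u K x) u"
      if "projected M k Q \<rho> m E u w" for m E u w
      using bspec[OF conjunct2[OF that[unfolded projected_def]] Mspace_const[of 1]] by simp
    have "inner_quad M Q (\<lambda>K x. \<rho> K x * wP K x) (\<lambda>K x. 1)
        = inner_quad M Q (\<lambda>K x. \<rho> K x * wH K x) (\<lambda>K x. 1)
          + dt P / reynolds P * a_strain M Q P us us
          + 2 * dt P / (3 * reynolds P) * a_div M Q us us"
      using wP_eq[OF Mspace_const[of 1]]
      by (simp add: a_diffusion_const a_strain_diagonal a_div_diagonal)
    moreover have "inner_quad M Q (\<lambda>K x. \<rho> K x *\<^sub>R uP K x) uP
        = inner_quad M Q (\<lambda>K x. \<rho> K x *\<^sub>R uH K x) uH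
          - 4 * (dt P / (2 * reynolds P) * a_strain M Q P us us
                 + dt P / (3 * reynolds P) * a_div M Q us us)"
      using us_eq[OF us] by (simp add: uP kinetic_energy_extrapolated)
    ultimately show ?thesis
      unfolding total[OF uwP] total[OF uwH] by (simp add: field_simps)
  qed
  have "mass M W = mass M U"
    using inner_quad_eq_mass[OF assms(2) W] inner_quad_eq_mass[OF assms(2,3)] momentum energy
    by (simp add: prod_eq_iff vec_eq_iff W_def \<rho>_def)
  then show "V \<in> state_space M k" "mass M V = mass M U"
    using V limited_state_space[OF assms(1) W] mass_limited[OF assms(1) W]
    by (simp_all add: W_def)
qed

section \<open>Conservation\<close>

theorem theorem1:
  fixes M :: "'d::finite mesh" and k :: nat and QH QP :: "'d quadrature"
    and S :: "'d cell \<Rightarrow> (real ^ 'd) set" and P :: params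
    and U V :: "('d, 'd state) dgfun"
  assumes "CARD('d) = 1 \<or> CARD('d) = 2"
    and "k \<ge> 1"
    and "wf_mesh M"
    and "wf_quadrature M QH" and "wf_quadrature M QP"
    and "exact_on_Qpoly M QH k" and "exact_on_Qpoly M QP k"
    and "gamma P > 1" and "reynolds P > 0" and "lam P > 0" and "dt P > 0"
    and "sigma P \<ge> 0" and "sigma_tilde P \<ge> 0" and "eps P > 0"
    and "\<forall>K\<in>cells M. finite (S K) \<and> S K \<noteq> {} \<and> S K \<subseteq> cell M K"
    and "U \<in> state_space M k"
    and "time_step M k QH QP S P U V"
  shows "inner_quad M QH (density_of U) (\<lambda>K x. 1) = inner_quad M QH (density_of V) (\<lambda>K x. 1) \<and>
    (\<forall>l. inner_quad M QH (\<lambda>K x. momentum_of U K x $ l) (\<lambda>K x. 1) =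
         inner_quad M QH (\<lambda>K x. momentum_of V K x $ l) (\<lambda>K x. 1)) \<and>
    inner_quad M QH (energy_of U) (\<lambda>K x. 1) = inner_quad M QH (energy_of V) (\<lambda>K x. 1)"
proof -
  note mesh = \<open>wf_mesh M\<close> and exactH = \<open>exact_on_Qpoly M QH k\<close>
    and exactP = \<open>exact_on_Qpoly M QP k\<close> and U = \<open>U \<in> state_space M k\<close>
  obtain UH UP where
    UH: "rk_step M k QH S P (dt P / 2) U UH" and
    UP: "parabolic_step M k QP S P UH UP" and
    V: "rk_step M k QH S P (dt P / 2) UP V"
    using \<open>time_step M k QH QP S P U V\<close> unfolding time_step_def by blast
  note UH_space = rk_step_state_space[OF mesh exactH U UH]
  note UP_space = parabolic_step_state_space[OF mesh exactP UH_space UP]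
  note V_space = rk_step_state_space[OF mesh exactH UP_space V]
  have "mass M V = mass M U"
    using mass_rk_step[OF mesh exactH U UH] mass_parabolic_step[OF mesh exactP UH_space UP]
      mass_rk_step[OF mesh exactH UP_space V] by simp
  then show ?thesis
    by (simp add: inner_quad_eq_mass[OF exactH U] inner_quad_eq_mass[OF exactH V_space])
qed

end
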